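(* Let $n\ge2$ and let $A=[a_{ij}]\in\mathbb{R}^{n\times n}$ be a nonnegative symmetric matrix with zero diagonal such that the undirected graph $\mathcal{G}(A)$ is connected. For $\alpha\in(0,1)$ consider the system $\dot x_i=u_i$, $i=1,\dots,n$, where $$u_i=\sum_{j=1}^n a_{ij}\operatorname{sig}(x_j-x_i)^{\alpha},$$ and let $B_\alpha=[a_{ij}^{\frac{2}{1+\alpha}}]$. Let $\lambda_2(L(B_\alpha))$ and $\lambda_n(L(B_\alpha))$ be the second smallest and the largest eigenvalues of the graph Laplacian $L(B_\alpha)$ (these are positive). Given $0<\alpha_*<\alpha^*<1$, let $$\epsilon^*=2^{-2}n^{\frac{2(1-\alpha_* )}{\alpha^*-\alpha_*}}\big(\lambda_n(L(B_{\alpha_*}))\big)^{\frac{1+\alpha_*}{\alpha^*-\alpha_*}}\big(\lambda_2(L(B_{\alpha^*}))\big)^{\frac{1+\alpha^*}{\alpha_*-\alpha^*}},$$ $$\epsilon_*=2^{-2}n^{\frac{2(1-\alpha^* )}{\alpha_*-\alpha^*}}\big(\lambda_n(L(B_{\alpha^*}))\big)^{\frac{1+\alpha^*}{\alpha_*-\alpha^*}}\big(\lambda_2(L(B_{\alpha_*}))\big)^{\frac{1+\alpha_*}{\alpha^*-\alpha_*}}.$$ Let $V_3=\frac12\sum_{i=1}^n\delta_i^2$, where $\delta_i=x_i-\frac1n\sum_{k=1}^n x_k$, and let $\left.\frac{dV_3}{dt}\right|_{\alpha}$ denote the time derivative of $V_3$ along the system with parameter $\alpha$ at the state $x\in\mathbb{R}^n$.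 Then, at every state $x$: if $V_3\ge\epsilon^*$, then $$\left.\frac{dV_3}{dt}\right|_{\alpha=\alpha^*}\le\left.\frac{dV_3}{dt}\right|_{\alpha=\alpha_*},$$ and if $V_3\le\epsilon_*$, then $$\left.\frac{dV_3}{dt}\right|_{\alpha=\alpha_*}\le\left.\frac{dV_3}{dt}\right|_{\alpha=\alpha^*}.$$
   Context: For $r\in\mathbb{R}$ and $\alpha>0$, $\operatorname{sig}(r)^\alpha:=\operatorname{sign}(r)|r|^\alpha$, with $\operatorname{sign}(0)=0$. The graph $\mathcal{G}(A)$ has vertices $v_1,\dots,v_n$ and an edge $(v_i,v_j)$ if and only if $a_{ji}>0$; it is undirected because $A^T=A$, and connected means that any two distinct vertices are joined by a path. The graph Laplacian $L(B)=[l_{ij}]$ of a nonnegative matrix $B=[b_{ij}]$ is given by $l_{ii}=\sum_{k\ne i}b_{ik}$ and $l_{ij}=-b_{ij}$ for $j\ne i$. The power $a_{ij}^{2/(1+\alpha)}$ is taken entrywise (and is $0$ when $a_{ij}=0$). The time derivative along the system at state $x$ is $\left.\frac{dV_3}{dt}\right|_{\alpha}=\sum_{i=1}^n\frac{\partial V_3}{\partial x_i}(x)\,u_i(x)$, with $u_i$ computed using the exponent $\alpha$; both derivatives in each inequality are evaluated at the same state. *)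

theory Defs
  imports
    "HOL-Analysis.Derivative"
    "Jordan_Normal_Form.Char_Poly"
    "Graph_Theory.Graph_Theory"
begin

unbundle no vec_syntax

text \<open>
  Vertices and coordinates are numbered from \<open>0\<close> to \<open>n - 1\<close>; vectors and matrices are the
  dimension-carrying \<^typ>\<open>real vec\<close> and \<^typ>\<open>real mat\<close>.
\<close>

definition sig :: "real \<Rightarrow> real \<Rightarrow> real" where
  "sig \<alpha> r = sgn r * \<bar>r\<bar> powr \<alpha>"

definition graph_of_mat :: "real mat \<Rightarrow> nat pair_pre_digraph" where
  "graph_of_mat A = \<lparr> pverts = {..<dim_row A},
     parcs = {(i, j). i < dim_row A \<and> j < dim_row A \<and> A $$ (j, i) > 0} \<rparr>"

definition laplacian :: "real mat \<Rightarrow> real mat" where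
  "laplacian B = mat (dim_row B) (dim_row B)
     (\<lambda>(i, j). if i = j then (\<Sum>k\<in>{..<dim_row B} - {i}. B $$ (i, k)) else - B $$ (i, j))"

text \<open>Note that \<open>0 powr c = 0\<close> for every \<open>c\<close>, so absent edges stay absent.\<close>

definition power_mat :: "real mat \<Rightarrow> real \<Rightarrow> real mat" where
  "power_mat A \<alpha> = map_mat (\<lambda>a. a powr (2 / (1 + \<alpha>))) A"

text \<open>
  \<open>eig k M\<close> is the \<open>k\<close>-th smallest (\<open>k = 1, 2, \<dots>\<close>) real eigenvalue of \<open>M\<close>, counted with
  multiplicity. If \<open>M\<close> is symmetric of dimension \<open>n\<close>, the sorted list has length \<open>n\<close>.
\<close>

definition sorted_eigenvalues :: "real mat \<Rightarrow> real list" where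
  "sorted_eigenvalues M = sorted_list_of_multiset (proots (char_poly M))"

definition eig :: "nat \<Rightarrow> real mat \<Rightarrow> real" where
  "eig k M = sorted_eigenvalues M ! (k - 1)"

definition protocol :: "real mat \<Rightarrow> real \<Rightarrow> real vec \<Rightarrow> real vec" where
  "protocol A \<alpha> x = vec (dim_vec x) (\<lambda>i. \<Sum>j<dim_vec x. A $$ (i, j) * sig \<alpha> (x $ j - x $ i))"

definition partial_deriv :: "(real vec \<Rightarrow> real) \<Rightarrow> nat \<Rightarrow> real vec \<Rightarrow> real" where
  "partial_deriv f i x = deriv (\<lambda>t. f (x |\<^sub>v i \<mapsto> t)) (x $ i)"

definition deriv_along :: "(real vec \<Rightarrow> real) \<Rightarrow> (real vec \<Rightarrow> real vec) \<Rightarrow> real vec \<Rightarrow> real" where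
  "deriv_along f u x = (\<Sum>i<dim_vec x. partial_deriv f i x * u x $ i)"

definition disagreement :: "real vec \<Rightarrow> nat \<Rightarrow> real" where
  "disagreement x i = x $ i - (1 / real (dim_vec x)) * (\<Sum>k<dim_vec x. x $ k)"

definition V\<^sub>3 :: "real vec \<Rightarrow> real" where
  "V\<^sub>3 x = (1 / 2) * (\<Sum>i<dim_vec x. (disagreement x i)\<^sup>2)"

text \<open>
  The two thresholds; \<open>\<alpha>l < \<alpha>u\<close> are the lower and upper exponent \<open>\<alpha>\<^sub>*\<close> and \<open>\<alpha>\<^sup>*\<close>, and
  \<open>n = dim_row A\<close>.
\<close>

definition eps_upper :: "real mat \<Rightarrow> real \<Rightarrow> real \<Rightarrow> real" where
  "eps_upper A \<alpha>l \<alpha>u = 2 powr (-2)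
     * real (dim_row A) powr (2 * (1 - \<alpha>l) / (\<alpha>u - \<alpha>l))
     * eig (dim_row A) (laplacian (power_mat A \<alpha>l)) powr ((1 + \<alpha>l) / (\<alpha>u - \<alpha>l))
     * eig 2 (laplacian (power_mat A \<alpha>u)) powr ((1 + \<alpha>u) / (\<alpha>l - \<alpha>u))"

definition eps_lower :: "real mat \<Rightarrow> real \<Rightarrow> real \<Rightarrow> real" where
  "eps_lower A \<alpha>l \<alpha>u = 2 powr (-2)
     * real (dim_row A) powr (2 * (1 - \<alpha>u) / (\<alpha>l - \<alpha>u))
     * eig (dim_row A) (laplacian (power_mat A \<alpha>u)) powr ((1 + \<alpha>u) / (\<alpha>l - \<alpha>u))
     * eig 2 (laplacian (power_mat A \<alpha>l)) powr ((1 + \<alpha>l) / (\<alpha>u - \<alpha>l))"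

end

theory Submission
  imports Defs "Jordan_Normal_Form.Schur_Decomposition"
begin

unbundle no inner_syntax

text \<open>
  The derivative of \<open>V\<^sub>3\<close> along the protocol with exponent \<open>\<alpha>\<close> is \<open>- E\<^sub>\<alpha> / 2\<close>, where
  \<open>E\<^sub>\<alpha> = \<Sum>\<^sub>i\<^sub>j a\<^sub>i\<^sub>j \<bar>x\<^sub>j - x\<^sub>i\<bar> powr (1 + \<alpha>)\<close>: since \<open>A\<close> is symmetric and \<open>sig\<close> is odd, the terms for
  \<open>(i, j)\<close> and \<open>(j, i)\<close> combine. So the claim compares \<open>E\<^sub>\<alpha>\<close> for two exponents.

  Put \<open>p = (1 + \<alpha>) / 2 \<in> (0, 1)\<close> and \<open>b\<^sub>i\<^sub>j = a\<^sub>i\<^sub>j powr (1 / p)\<close>. Then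
  \<open>E\<^sub>\<alpha> = \<Sum>\<^sub>i\<^sub>j (b\<^sub>i\<^sub>j (x\<^sub>j - x\<^sub>i)\<^sup>2) powr p\<close>, a sum of \<open>n\<^sup>2\<close> powers, so that with
  \<open>S = \<Sum>\<^sub>i\<^sub>j b\<^sub>i\<^sub>j (x\<^sub>j - x\<^sub>i)\<^sup>2\<close> subadditivity and concavity of \<open>t powr p\<close> give
  \<open>S powr p \<le> E\<^sub>\<alpha> \<le> (n\<^sup>2) powr (1 - p) * S powr p\<close>. Moreover \<open>S\<close> is twice the quadratic form of the
  Laplacian of \<open>B\<^sub>\<alpha>\<close> at the disagreement vector \<open>\<delta>\<close>, and \<open>\<delta>\<close> is orthogonal to the constant vectors
  with \<open>\<delta> \<bullet> \<delta> = 2 V\<^sub>3\<close>; hence \<open>4 \<lambda>\<^sub>2 V\<^sub>3 \<le> S \<le> 4 \<lambda>\<^sub>n V\<^sub>3\<close>. Together these are the two bounds in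
  \<open>edge_energy_bounds\<close>.

  For \<open>V\<^sub>3 > 0\<close> the upper bound for \<open>E\<^sub>\<alpha>\<close> is at most the lower bound for \<open>E\<^sub>\<beta>\<close> exactly when \<open>V\<^sub>3\<close> lies on the
  appropriate side of \<open>eps_upper A \<alpha> \<beta>\<close>: taking logarithms makes the comparison linear in \<open>ln V\<^sub>3\<close>
  with slope proportional to \<open>\<beta> - \<alpha>\<close>, so the side is above the threshold if \<open>\<alpha> < \<beta>\<close> and below it if
  \<open>\<beta> < \<alpha>\<close> (\<open>threshold_comparison\<close>). The lower threshold is the upper one with the exponents
  exchanged, so both halves of the theorem are instances of \<open>edge_energy_comparison\<close>.

  The eigenvalues are defined as sorted roots of the characteristic polynomial. They are tied to
  quadratic forms by the spectral theorem for real symmetric matrices: there is an orthonormal basis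
  \<open>u\<close> whose vector \<open>u k\<close> belongs to the eigenvalue number \<open>k + 1\<close> in the sorted list
  (\<open>orthonormal_eigenbasis\<close>). Connectedness enters through the kernel of the Laplacian, which then
  consists of the constant vectors only; this gives \<open>\<lambda>\<^sub>2 > 0\<close> and the bound from below on their
  orthogonal complement (\<open>second_eigenvalue_of_simple_kernel\<close>).
\<close>

section \<open>Sums of powers with exponent at most one\<close>

text \<open>
  Each ratio \<open>r = y k / sum y I\<close> lies in \<open>[0, 1]\<close>, so \<open>r \<le> r powr p\<close>; the ratios add up to \<open>1\<close>.
\<close>

lemma sum_powr_ge:
  fixes y :: "'a \<Rightarrow> real"
  assumes "finite I" and y: "\<And>k. k \<in> I \<Longrightarrow> 0 \<le> y k" and p: "0 < p" "p \<le> 1"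
  shows "(\<Sum>k\<in>I. y k) powr p \<le> (\<Sum>k\<in>I. y k powr p)"
proof (cases "(\<Sum>k\<in>I. y k) = 0")
  case True
  then show ?thesis by (simp add: sum_nonneg)
next
  case False
  let ?S = "\<Sum>k\<in>I. y k"
  have S: "?S > 0" using False sum_nonneg[of I y] y by force
  have "1 = (\<Sum>k\<in>I. y k / ?S)" using S by (simp flip: sum_divide_distrib)
  also have "\<dots> \<le> (\<Sum>k\<in>I. (y k / ?S) powr p)"
  proof (rule sum_mono)
    fix k assume k: "k \<in> I"
    have "0 \<le> y k / ?S" "y k / ?S \<le> 1" using S y k member_le_sum[of k I y] assms(1) by auto
    then show "y k / ?S \<le> (y k / ?S) powr p"
      using p powr_mono'[of p 1 "y k / ?S"] by (metis powr_one)
  qed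
  also have "\<dots> = (\<Sum>k\<in>I. y k powr p) / ?S powr p"
    using S y by (simp add: powr_divide sum_divide_distrib)
  finally show ?thesis using S by (simp add: field_simps)
qed

text \<open>
  Bernoulli's inequality: the concave function \<open>t powr p\<close> lies below its tangent at \<open>1\<close>. The proof
  takes it from the concavity of \<open>ln\<close> between \<open>1\<close> and \<open>t\<close>.
\<close>

lemma powr_le_tangent:
  fixes t :: real
  assumes "0 \<le> t" "0 < p" "p \<le> 1"
  shows "t powr p \<le> 1 + p * (t - 1)"
proof (cases "t = 0")
  case False
  then have t: "t > 0" using assms by simp
  have "ln (1 + p * (t - 1)) \<ge> p * ln t"
    using concave_onD[OF ln_concave, of p 1 t] assms t by (simp add: algebra_simps)
  moreover have "1 + p * (t - 1) > 0"
  proof -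
    have "p * (1 - t) < 1" using assms t by (smt (verit) mult_left_le_one_le mult_nonneg_nonpos)
    then show ?thesis by (simp add: algebra_simps)
  qed
  ultimately show ?thesis using t by (simp add: powr_def ln_ge_iff)
qed (use assms in simp)

text \<open>
  Jensen's inequality for the concave function \<open>t powr p\<close>: after division by the mean \<open>m\<close> of the
  \<open>y k\<close>, the tangent bounds sum to the number of terms, because the linear parts cancel.
\<close>

lemma sum_powr_le:
  fixes y :: "'a \<Rightarrow> real"
  assumes "finite I" and y: "\<And>k. k \<in> I \<Longrightarrow> 0 \<le> y k" and p: "0 < p" "p \<le> 1"
  shows "(\<Sum>k\<in>I. y k powr p) \<le> real (card I) powr (1 - p) * (\<Sum>k\<in>I. y k) powr p"
proof (cases "(\<Sum>k\<in>I. y k) = 0")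
  case True
  then have "y k = 0" if "k \<in> I" for k using that y assms(1) by (simp add: sum_nonneg_eq_0_iff)
  then show ?thesis using True by simp
next
  case False
  let ?S = "\<Sum>k\<in>I. y k" and ?N = "real (card I)"
  have S: "?S > 0" using False sum_nonneg[of I y] y by force
  have N: "?N > 0" using False assms(1) by (cases "I = {}") (auto simp: card_gt_0_iff)
  define m where "m = ?S / ?N"
  have m: "m > 0" unfolding m_def using S N by simp
  have "(\<Sum>k\<in>I. y k powr p) = m powr p * (\<Sum>k\<in>I. (y k / m) powr p)"
    using m y by (simp add: powr_divide sum_distrib_left)
  also have "\<dots> \<le> m powr p * (\<Sum>k\<in>I. 1 + p * (y k / m - 1))"
    using m y p by (intro mult_left_mono sum_mono powr_le_tangent) auto
  also have "(\<Sum>k\<in>I. 1 + p * (y k / m - 1)) = ?N"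
  proof -
    have "(\<Sum>k\<in>I. y k / m) = ?N" unfolding m_def using S by (simp flip: sum_divide_distrib sum_distrib_right)
    then show ?thesis by (simp add: sum.distrib sum_subtractf flip: sum_distrib_left)
  qed
  also have "m powr p * ?N = ?N powr (1 - p) * ?S powr p"
    unfolding m_def using S N by (simp add: powr_divide powr_diff)
  finally show ?thesis .
qed

section \<open>Orthonormal eigenbases of real symmetric matrices\<close>

lemma scalar_prod_self_pos:
  fixes v :: "real vec"
  assumes "v \<in> carrier_vec n" and "v \<noteq> 0\<^sub>v n"
  shows "v \<bullet> v > 0"
  using conjugate_square_greater_0_vec[OF assms(1)] assms(2) by simp

text \<open>
  Complete \<open>v\<close> to a basis, orthogonalise it keeping \<open>v\<close> as the first vector, and normalise.
\<close>

lemma orthogonal_completion: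
  fixes v :: "real vec"
  assumes v: "v \<in> carrier_vec n" and v1: "v \<bullet> v = 1"
  obtains W where "W \<in> carrier_mat n n" "W\<^sup>T * W = 1\<^sub>m n" "col W 0 = v"
proof -
  interpret cof_vec_space n "TYPE(real)" .
  have v0: "v \<noteq> 0\<^sub>v n" using v1 v by auto
  then have n: "0 < n" using v by (cases n) auto
  define b where "b = basis_completion v"
  define ws where "ws = gram_schmidt n b"
  note bc = basis_completion[OF v v0, folded b_def]
  have b: "set b \<subseteq> carrier_vec n" using bc(2) .
  obtain vs where bv: "b = v # vs" using bc(6,7) n by (cases b) auto
  have ws: "set ws \<subseteq> carrier_vec n" "corthogonal ws" "length ws = n"
    using gram_schmidt_result[OF b bc(4,5) refl, folded ws_def] bc(6) by auto
  have hdws: "ws ! 0 = v"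
    using gram_schmidt_hd[OF v, of vs, folded bv] ws(3) n unfolding ws_def
    by (metis hd_conv_nth length_greater_0_conv)
  have wi: "ws ! i \<in> carrier_vec n" if "i < n" for i using ws that by auto
  have orth: "ws ! i \<bullet> ws ! j = 0 \<longleftrightarrow> i \<noteq> j" if "i < n" "j < n" for i j
    using corthogonalD[OF ws(2), of i j] that ws(3) by simp
  have pos: "ws ! i \<bullet> ws ! i > 0" if "i < n" for i
    using orth[OF that that] scalar_prod_self_pos[OF wi[OF that]] wi[OF that] by fastforce
  define W where "W = mat_of_cols n (map (\<lambda>w. (1 / sqrt (w \<bullet> w)) \<cdot>\<^sub>v w) ws)"
  have W: "W \<in> carrier_mat n n" unfolding W_def using ws(3) mat_of_cols_carrier(1) by (metis length_map)
  have col: "col W i = (1 / sqrt (ws ! i \<bullet> ws ! i)) \<cdot>\<^sub>v ws ! i" if "i < n" for i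
    unfolding W_def using that ws(3) wi by (subst col_mat_of_cols) auto
  have "W\<^sup>T * W = 1\<^sub>m n"
  proof (rule eq_matI)
    fix i j assume ij: "i < dim_row (1\<^sub>m n :: real mat)" "j < dim_col (1\<^sub>m n :: real mat)"
    then have "(W\<^sup>T * W) $$ (i, j) = col W i \<bullet> col W j" using W by auto
    also have "\<dots> = (ws ! i \<bullet> ws ! j) / (sqrt (ws ! i \<bullet> ws ! i) * sqrt (ws ! j \<bullet> ws ! j))"
      using ij col wi by (simp add: smult_scalar_prod_distrib[of _ n] scalar_prod_smult_distrib[of _ n])
    also have "\<dots> = 1\<^sub>m n $$ (i, j)"
      using ij orth[of i j] pos[of i] by auto
    finally show "(W\<^sup>T * W) $$ (i, j) = 1\<^sub>m n $$ (i, j)" .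
  qed (use W in auto)
  moreover have "col W 0 = v" using col[OF n] hdws v1 by simp
  ultimately show ?thesis using that W by blast
qed

text \<open>
  The characteristic polynomial has a complex root \<open>z\<close>. For a complex eigenvector \<open>w\<close> of it,
  symmetry lets the real matrix move across the Hermitian product \<open>w \<bullet>c w\<close>, so \<open>z\<close> equals its
  conjugate and is a real root.
\<close>

lemma symmetric_real_eigenvector:
  fixes M :: "real mat"
  assumes M: "M \<in> carrier_mat n n" and sym: "M\<^sup>T = M" and n: "n > 0"
  obtains e v where "v \<in> carrier_vec n" "v \<bullet> v = 1" "M *\<^sub>v v = e \<cdot>\<^sub>v v"
proof -
  \<comment> \<open>The matrix \<open>M\<close> over the complex numbers, where its characteristic polynomial splits.\<close>
  let ?C = "map_mat complex_of_real M"
  have C: "?C \<in> carrier_mat n n" using M by auto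
  obtain as where as: "char_poly ?C = (\<Prod>a\<leftarrow>as. [:- a, 1:])" "length as = n"
    using char_poly_factorized[OF C] by blast
  then obtain z as' where "as = z # as'" using n by (cases as) auto
  then have "poly (char_poly ?C) z = 0" using as by simp
  then obtain w where w: "w \<in> carrier_vec n" "w \<noteq> 0\<^sub>v n" "?C *\<^sub>v w = z \<cdot>\<^sub>v w"
    using eigenvalue_root_char_poly[OF C] C unfolding eigenvalue_def eigenvector_def by auto
  have CT: "?C\<^sup>T = ?C" using sym by (metis map_mat_transpose)
  have cw: "conjugate w \<in> carrier_vec n" using w by simp
  have Cc: "?C *\<^sub>v conjugate w = conjugate (?C *\<^sub>v w)"
    by (rule eq_vecI) (use C w(1) in \<open>auto simp: scalar_prod_def conjugate_complex_def\<close>)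
  have "z * (w \<bullet>c w) = (?C *\<^sub>v w) \<bullet>c w" using w cw by simp
  also have "\<dots> = w \<bullet> (?C *\<^sub>v conjugate w)"
    using transpose_vec_mult_scalar[OF C cw w(1)] CT w(1) cw C
    by (metis mult_mat_vec_carrier comm_scalar_prod)
  also have "\<dots> = cnj z * (w \<bullet>c w)"
    unfolding Cc w(3) using w(1) cw by (simp add: conjugate_smult_vec)
  finally have "z = cnj z" using w conjugate_square_eq_0_vec[OF w(1)] by simp
  then obtain e where z: "z = complex_of_real e" by (metis complex_is_Real_iff Reals_cnj_iff Reals_cases)
  have "complex_of_real (poly (char_poly M) e) = 0"
    using \<open>poly (char_poly ?C) z = 0\<close> unfolding z of_real_hom.char_poly_hom[OF M] by simp
  then have "poly (char_poly M) e = 0" by simp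
  then obtain u where u: "u \<in> carrier_vec n" "u \<noteq> 0\<^sub>v n" "M *\<^sub>v u = e \<cdot>\<^sub>v u"
    using eigenvalue_root_char_poly[OF M] M unfolding eigenvalue_def eigenvector_def by auto
  have uu: "u \<bullet> u > 0"
    using u scalar_prod_self_pos by blast
  let ?v = "(1 / sqrt (u \<bullet> u)) \<cdot>\<^sub>v u"
  show ?thesis
  proof
    show "?v \<in> carrier_vec n" using u by simp
    show "?v \<bullet> ?v = 1" using u uu by simp
    show "M *\<^sub>v ?v = e \<cdot>\<^sub>v ?v"
      using u M by (simp add: mult_mat_vec smult_smult_assoc mult.commute)
  qed
qed

text \<open>
  Deflation: in an orthonormal basis that starts with an eigenvector, the first column of the matrix
  is a multiple of the first unit vector, and by symmetry so is its first row. The remaining block is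
  symmetric and one dimension smaller.
\<close>

lemma orthogonal_diagonalization:
  fixes M :: "real mat"
  assumes "M \<in> carrier_mat n n" and "M\<^sup>T = M"
  shows "\<exists>U d. U \<in> carrier_mat n n \<and> U\<^sup>T * U = 1\<^sub>m n \<and> U\<^sup>T * M * U = mat_diag n d"
  using assms
proof (induction n arbitrary: M)
  case 0
  then have "(1\<^sub>m 0)\<^sup>T * 1\<^sub>m 0 = (1\<^sub>m 0 :: real mat)" "(1\<^sub>m 0)\<^sup>T * M * 1\<^sub>m 0 = mat_diag 0 (\<lambda>_. 0)"
    by (auto simp: mat_diag_def)
  then show ?case by (metis one_carrier_mat)
next
  case (Suc m)
  note M = Suc.prems(1) and sym = Suc.prems(2)
  obtain e v where v: "v \<in> carrier_vec (Suc m)" "v \<bullet> v = 1" "M *\<^sub>v v = e \<cdot>\<^sub>v v"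
    using symmetric_real_eigenvector[OF M sym] by blast
  obtain W where W: "W \<in> carrier_mat (Suc m) (Suc m)" "W\<^sup>T * W = 1\<^sub>m (Suc m)" "col W 0 = v"
    using orthogonal_completion[OF v(1,2)] by blast
  \<comment> \<open>The matrix \<open>M\<close> in the orthonormal basis of the columns of \<open>W\<close>.\<close>
  define A where "A = W\<^sup>T * M * W"
  have A: "A \<in> carrier_mat (Suc m) (Suc m)" unfolding A_def using W M by auto
  have A_assoc: "A = W\<^sup>T * (M * W)" unfolding A_def using W M by simp
  have A_sym: "A\<^sup>T = A"
  proof -
    have "A\<^sup>T = (M * W)\<^sup>T * W"
      unfolding A_assoc using transpose_mult[of "W\<^sup>T" "Suc m" "Suc m" "M * W" "Suc m"] W M by simp
    also have "(M * W)\<^sup>T = W\<^sup>T * M" using transpose_mult[OF M W(1)] sym by simp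
    finally show ?thesis unfolding A_def .
  qed
  have A_col: "A $$ (i, 0) = (if i = 0 then e else 0)" if "i < Suc m" for i
  proof -
    have "A $$ (i, 0) = col W i \<bullet> col (M * W) 0"
      unfolding A_assoc using that W M by (subst index_mult_mat) auto
    also have "col (M * W) 0 = e \<cdot>\<^sub>v v" using W M v by (subst col_mult2[OF M W(1)]) auto
    also have "col W i \<bullet> (e \<cdot>\<^sub>v v) = e * (col W i \<bullet> col W 0)"
      using W v that by (simp add: scalar_prod_smult_distrib[of _ "Suc m"])
    also have "col W i \<bullet> col W 0 = (W\<^sup>T * W) $$ (i, 0)" using W(1) that by simp
    finally show ?thesis using W(2) that by simp
  qed
  obtain A1 A2 A0 A3 where split: "split_block A 1 1 = (A1, A2, A0, A3)"
    by (cases "split_block A 1 1") auto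
  have dims: "dim_row A = 1 + m" "dim_col A = 1 + m" using A by auto
  note blk = split_block[OF split dims]
  have A1: "A1 = mat_diag 1 (\<lambda>_. e)"
    using split A_col[of 0] by (auto simp: split_block_def Let_def mat_diag_def intro!: eq_matI)
  have A0: "A0 = 0\<^sub>m m 1"
    using split A_col dims by (auto simp: split_block_def Let_def intro!: eq_matI)
  have A2: "A2 = 0\<^sub>m 1 m"
  proof -
    have "A $$ (0, Suc j) = 0" if "j < m" for j
      using A_col[of "Suc j"] arg_cong[OF A_sym, of "\<lambda>B. B $$ (0, Suc j)"] A that by simp
    then show ?thesis using split dims by (auto simp: split_block_def Let_def intro!: eq_matI)
  qed
  have "A3\<^sup>T = A3"
  proof (rule eq_matI)
    fix i j assume "i < dim_row A3" "j < dim_col A3"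
    then have ij: "i < m" "j < m" using blk(4) by auto
    have "A $$ (Suc i, Suc j) = A $$ (Suc j, Suc i)"
      using arg_cong[OF A_sym, of "\<lambda>B. B $$ (Suc i, Suc j)"] A ij by simp
    then show "A3\<^sup>T $$ (i, j) = A3 $$ (i, j)"
      using ij dims split by (auto simp: split_block_def Let_def)
  qed (use blk(4) in auto)
  then obtain U' d where U': "U' \<in> carrier_mat m m" "U'\<^sup>T * U' = 1\<^sub>m m" "U'\<^sup>T * A3 * U' = mat_diag m d"
    using Suc.IH[OF blk(4)] by blast
  define Q where "Q = four_block_mat (1\<^sub>m 1) (0\<^sub>m 1 m) (0\<^sub>m m 1) U'"
  have Q: "Q \<in> carrier_mat (Suc m) (Suc m)"
    unfolding Q_def using four_block_carrier_mat[of "1\<^sub>m 1" 1 1 U' m m] U' by simp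
  have QT: "Q\<^sup>T = four_block_mat (1\<^sub>m 1) (0\<^sub>m 1 m) (0\<^sub>m m 1) U'\<^sup>T"
    unfolding Q_def using U' by (subst transpose_four_block_mat[of _ 1 1 _ m _ m]) auto
  have QTQ: "Q\<^sup>T * Q = 1\<^sub>m (Suc m)"
    unfolding QT unfolding Q_def using U'
    by (subst mult_four_block_mat[of _ 1 1 _ m _ m _ _ 1 _ m]) (auto intro!: eq_matI)
  have QTA: "Q\<^sup>T * A = four_block_mat A1 (0\<^sub>m 1 m) (0\<^sub>m m 1) (U'\<^sup>T * A3)"
    unfolding QT blk(5) A0 A2 using U' blk
    by (subst mult_four_block_mat[of _ 1 1 _ m _ m _ _ 1 _ m]) auto
  have "Q\<^sup>T * A * Q = four_block_mat A1 (0\<^sub>m 1 m) (0\<^sub>m m 1) (mat_diag m d)"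
    unfolding QTA unfolding Q_def U'(3)[symmetric] using U' blk
    by (subst mult_four_block_mat[of _ 1 1 _ m _ m _ _ 1 _ m]) auto
  also have "\<dots> = mat_diag (Suc m) (case_nat e d)"
    unfolding A1 by (rule eq_matI) (auto simp: mat_diag_def split: nat.splits)
  finally have QAQ: "Q\<^sup>T * A * Q = mat_diag (Suc m) (case_nat e d)" .
  have WQ: "W * Q \<in> carrier_mat (Suc m) (Suc m)" using W Q by simp
  have WQT: "(W * Q)\<^sup>T = Q\<^sup>T * W\<^sup>T" using transpose_mult[OF W(1) Q] .
  have "(W * Q)\<^sup>T * (W * Q) = Q\<^sup>T * (W\<^sup>T * W) * Q"
    unfolding WQT using W(1) Q by (simp add: assoc_mult_mat[of _ "Suc m" "Suc m" _ "Suc m" _ "Suc m"])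
  then have 1: "(W * Q)\<^sup>T * (W * Q) = 1\<^sub>m (Suc m)" using W Q QTQ by simp
  have "(W * Q)\<^sup>T * M * (W * Q) = Q\<^sup>T * A * Q"
    unfolding WQT A_def using W(1) Q M by (simp add: assoc_mult_mat[of _ "Suc m" "Suc m" _ "Suc m" _ "Suc m"])
  with 1 QAQ WQ show ?case by metis
qed

text \<open>
  An orthogonal conjugation is a similarity, so the characteristic polynomial, and with it the
  multiset of its roots, is that of the diagonal matrix.
\<close>

lemma sorted_eigenvalues_diagonal:
  fixes M :: "real mat"
  assumes M: "M \<in> carrier_mat n n" and U: "U \<in> carrier_mat n n" "U\<^sup>T * U = 1\<^sub>m n"
    and diag: "U\<^sup>T * M * U = mat_diag n d"
  shows "sorted_eigenvalues M = sort (map d [0..<n])"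
proof -
  have UT: "U * U\<^sup>T = 1\<^sub>m n" using mat_mult_left_right_inverse[OF _ U(1) U(2)] U(1) by simp
  have "U * (mat_diag n d) * U\<^sup>T = (U * U\<^sup>T) * M * (U * U\<^sup>T)"
    unfolding diag[symmetric] using U(1) M by (simp add: assoc_mult_mat[of _ n n _ n _ n])
  then have "M = U * mat_diag n d * U\<^sup>T" using M UT by simp
  then have "similar_mat M (mat_diag n d)"
    by (intro similar_matI[of _ _ U "U\<^sup>T" n]) (use M U UT in auto)
  then have "char_poly M = char_poly (mat_diag n d)" by (rule char_poly_similar)
  also have "\<dots> = (\<Prod>a\<leftarrow>diag_mat (mat_diag n d). [:- a, 1:])"
    by (rule char_poly_upper_triangular[of _ n]) (auto simp: mat_diag_def)
  also have "diag_mat (mat_diag n d) = map d [0..<n]"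
    unfolding diag_mat_def by (auto simp: mat_diag_def)
  finally have cp: "char_poly M = (\<Prod>a\<leftarrow>map d [0..<n]. [:- a, 1:])" .
  have "proots (\<Prod>a\<leftarrow>xs. [:- a, 1:]) = mset xs" for xs :: "real list"
  proof (induction xs)
    case (Cons x xs)
    have "(\<Prod>a\<leftarrow>xs. [:- a, 1:]) \<noteq> 0" by (auto simp: prod_list_zero_iff)
    then have "proots ([:- x, 1:] * (\<Prod>a\<leftarrow>xs. [:- a, 1:])) = add_mset x (mset xs)"
      using Cons by (subst proots_mult) auto
    then show ?case by simp
  qed simp
  then show ?thesis unfolding sorted_eigenvalues_def cp by (simp only: sorted_list_of_multiset_mset)
qed

text \<open>
  The spectral theorem in the form used below: the columns of a diagonalising orthogonal matrix,
  permuted so that their eigenvalues come in the order of the sorted list. The last conclusion is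
  Parseval's identity in its bilinear form.
\<close>

lemma orthonormal_eigenbasis:
  fixes M :: "real mat"
  assumes M: "M \<in> carrier_mat n n" and sym: "M\<^sup>T = M"
  obtains u where
    "\<And>k. k < n \<Longrightarrow> u k \<in> carrier_vec n"
    "\<And>k. k < n \<Longrightarrow> M *\<^sub>v u k = eig (Suc k) M \<cdot>\<^sub>v u k"
    "\<And>j k. j < n \<Longrightarrow> k < n \<Longrightarrow> u j \<bullet> u k = (if j = k then 1 else 0)"
    "\<And>x y. x \<in> carrier_vec n \<Longrightarrow> y \<in> carrier_vec n \<Longrightarrow> x \<bullet> y = (\<Sum>k<n. (u k \<bullet> x) * (u k \<bullet> y))"
proof -
  obtain U d where U: "U \<in> carrier_mat n n" "U\<^sup>T * U = 1\<^sub>m n"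
    and diag: "U\<^sup>T * M * U = mat_diag n d"
    using orthogonal_diagonalization[OF M sym] by blast
  have UT: "U * U\<^sup>T = 1\<^sub>m n" using mat_mult_left_right_inverse[OF _ U(1) U(2)] U(1) by simp
  let ?ds = "map d [0..<n]"
  note se = sorted_eigenvalues_diagonal[OF M U diag]
  \<comment> \<open>The permutation that sorts the diagonal entries also reorders the eigenvectors.\<close>
  obtain p where p: "p permutes {..<n}" "permute_list p ?ds = sort ?ds"
    using mset_eq_permutation[of "sort ?ds" ?ds] by auto
  have pn: "p k < n" if "k < n" for k using permutes_in_image[OF p(1), of k] that by simp
  have eig: "eig (Suc k) M = d (p k)" if "k < n" for k
    unfolding eig_def se p(2)[symmetric] using p(1) that pn by (simp add: permute_list_nth)
  have "M * U = U * mat_diag n d"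
  proof -
    have "U * mat_diag n d = (U * U\<^sup>T) * (M * U)"
      unfolding diag[symmetric] using U(1) M by (simp add: assoc_mult_mat[of _ n n _ n _ n])
    then show ?thesis using UT M U by simp
  qed
  then have ev: "M *\<^sub>v col U k = d k \<cdot>\<^sub>v col U k" if "k < n" for k
  proof -
    have "M *\<^sub>v col U k = col (U * mat_diag n d) k"
      using col_mult2[OF M U(1) that] \<open>M * U = _\<close> by simp
    also have "\<dots> = d k \<cdot>\<^sub>v col U k"
      using U(1) that by (auto simp: mat_diag_mult_right intro!: eq_vecI)
    finally show ?thesis .
  qed
  show ?thesis
  proof (rule that[of "\<lambda>k. col U (p k)"])
    show "col U (p k) \<in> carrier_vec n" if "k < n" for k using U pn that by auto
    show "M *\<^sub>v col U (p k) = eig (Suc k) M \<cdot>\<^sub>v col U (p k)" if "k < n" for k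
      using ev[OF pn[OF that]] eig[OF that] by simp
    show "col U (p j) \<bullet> col U (p k) = (if j = k then 1 else 0)" if "j < n" "k < n" for j k
    proof -
      have "col U (p j) \<bullet> col U (p k) = (U\<^sup>T * U) $$ (p j, p k)"
        using U(1) pn that by simp
      then show ?thesis using U(2) pn that permutes_inj[OF p(1)] by (auto dest: injD)
    qed
    show "x \<bullet> y = (\<Sum>k<n. (col U (p k) \<bullet> x) * (col U (p k) \<bullet> y))"
      if x: "x \<in> carrier_vec n" and y: "y \<in> carrier_vec n" for x y
    proof -
      have "y = U *\<^sub>v (U\<^sup>T *\<^sub>v y)" using U(1) UT y by (metis assoc_mult_mat_vec one_mult_mat_vec transpose_carrier_mat)
      then have "x \<bullet> y = x \<bullet> (U *\<^sub>v (U\<^sup>T *\<^sub>v y))" by simp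
      also have "\<dots> = (U\<^sup>T *\<^sub>v x) \<bullet> (U\<^sup>T *\<^sub>v y)"
        using transpose_vec_mult_scalar[OF U(1) _ x, of "U\<^sup>T *\<^sub>v y"] U(1) x y by simp
      also have "\<dots> = (\<Sum>k<n. (col U k \<bullet> x) * (col U k \<bullet> y))"
        using U(1) x y by (simp add: scalar_prod_def atLeast0LessThan)
      also have "\<dots> = (\<Sum>k<n. (col U (p k) \<bullet> x) * (col U (p k) \<bullet> y))"
        using sum.permute[OF p(1), of "\<lambda>k. (col U k \<bullet> x) * (col U k \<bullet> y)"] by (simp add: o_def)
      finally show ?thesis .
    qed
  qed
qed

lemma eig_mono:
  fixes M :: "real mat"
  assumes M: "M \<in> carrier_mat n n" and sym: "M\<^sup>T = M" and "1 \<le> j" "j \<le> k" "k \<le> n"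
  shows "eig j M \<le> eig k M"
proof -
  obtain U d where U: "U \<in> carrier_mat n n" "U\<^sup>T * U = 1\<^sub>m n"
    and diag: "U\<^sup>T * M * U = mat_diag n d"
    using orthogonal_diagonalization[OF M sym] by blast
  have "length (sorted_eigenvalues M) = n" "sorted (sorted_eigenvalues M)"
    unfolding sorted_eigenvalues_diagonal[OF M U diag] by simp_all
  then show ?thesis unfolding eig_def using assms(3-5) by (intro sorted_nth_mono) auto
qed

section \<open>Rayleigh quotients\<close>

lemma symmetric_scalar_prod_swap:
  fixes M :: "real mat"
  assumes "M \<in> carrier_mat n n" and "M\<^sup>T = M" and "x \<in> carrier_vec n" and "y \<in> carrier_vec n"
  shows "y \<bullet> (M *\<^sub>v x) = (M *\<^sub>v y) \<bullet> x"
  using transpose_vec_mult_scalar[OF assms(1,3,4)] assms(2) by simp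

lemma quadratic_form_eigen_expansion:
  fixes M :: "real mat"
  assumes M: "M \<in> carrier_mat n n" and sym: "M\<^sup>T = M" and x: "x \<in> carrier_vec n"
    and u: "\<And>k. k < n \<Longrightarrow> u k \<in> carrier_vec n"
    and ev: "\<And>k. k < n \<Longrightarrow> M *\<^sub>v u k = l k \<cdot>\<^sub>v u k"
    and pars: "\<And>x y. x \<in> carrier_vec n \<Longrightarrow> y \<in> carrier_vec n \<Longrightarrow>
      x \<bullet> y = (\<Sum>k<n. (u k \<bullet> x) * (u k \<bullet> y))"
  shows "x \<bullet> (M *\<^sub>v x) = (\<Sum>k<n. l k * (u k \<bullet> x)\<^sup>2)"
proof -
  have "x \<bullet> (M *\<^sub>v x) = (\<Sum>k<n. (u k \<bullet> x) * (u k \<bullet> (M *\<^sub>v x)))"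
    using pars x M by simp
  also have "\<dots> = (\<Sum>k<n. l k * (u k \<bullet> x)\<^sup>2)"
    using symmetric_scalar_prod_swap[OF M sym x u] u x ev
    by (intro sum.cong) (auto simp: power2_eq_square)
  finally show ?thesis .
qed

lemma rayleigh_le_largest_eigenvalue:
  fixes M :: "real mat"
  assumes M: "M \<in> carrier_mat n n" and sym: "M\<^sup>T = M" and x: "x \<in> carrier_vec n"
  shows "x \<bullet> (M *\<^sub>v x) \<le> eig n M * (x \<bullet> x)"
proof -
  obtain u where u: "\<And>k. k < n \<Longrightarrow> u k \<in> carrier_vec n"
    and ev: "\<And>k. k < n \<Longrightarrow> M *\<^sub>v u k = eig (Suc k) M \<cdot>\<^sub>v u k"
    and "\<And>j k. j < n \<Longrightarrow> k < n \<Longrightarrow> u j \<bullet> u k = (if j = k then 1 else 0)"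
    and pars: "\<And>x y. x \<in> carrier_vec n \<Longrightarrow> y \<in> carrier_vec n \<Longrightarrow>
      x \<bullet> y = (\<Sum>k<n. (u k \<bullet> x) * (u k \<bullet> y))"
    using that by (rule orthonormal_eigenbasis[OF M sym])
  have "x \<bullet> (M *\<^sub>v x) = (\<Sum>k<n. eig (Suc k) M * (u k \<bullet> x)\<^sup>2)"
    by (rule quadratic_form_eigen_expansion[OF M sym x u ev pars])
  also have "\<dots> \<le> (\<Sum>k<n. eig n M * (u k \<bullet> x)\<^sup>2)"
    by (intro sum_mono mult_right_mono eig_mono[OF M sym]) auto
  also have "\<dots> = eig n M * (x \<bullet> x)"
    using pars[OF x x] by (simp add: sum_distrib_left power2_eq_square)
  finally show ?thesis .
qed

text \<open>
  If the two smallest eigenvalues both vanished, two orthonormal eigenvectors would be multiples of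
  the same \<open>z\<close>; hence the second one is positive. Then every \<open>u k\<close> with \<open>k \<noteq> 0\<close> belongs to a nonzero
  eigenvalue and is orthogonal to \<open>z\<close>, so that \<open>z\<close> is a multiple of \<open>u 0\<close>. A vector orthogonal to
  \<open>z\<close> therefore has no component along \<open>u 0\<close>, and only eigenvalues from the second on contribute to
  its quadratic form.
\<close>

lemma second_eigenvalue_of_simple_kernel:
  fixes M :: "real mat"
  assumes M: "M \<in> carrier_mat n n" and sym: "M\<^sup>T = M" and n: "2 \<le> n"
    and psd: "\<And>x. x \<in> carrier_vec n \<Longrightarrow> 0 \<le> x \<bullet> (M *\<^sub>v x)"
    and z: "z \<in> carrier_vec n" "z \<noteq> 0\<^sub>v n" "M *\<^sub>v z = 0\<^sub>v n"
    and kernel: "\<And>y. y \<in> carrier_vec n \<Longrightarrow> M *\<^sub>v y = 0\<^sub>v n \<Longrightarrow> \<exists>c. y = c \<cdot>\<^sub>v z"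
  shows "0 < eig 2 M"
    and "\<And>x. x \<in> carrier_vec n \<Longrightarrow> x \<bullet> z = 0 \<Longrightarrow> eig 2 M * (x \<bullet> x) \<le> x \<bullet> (M *\<^sub>v x)"
proof -
  obtain u where u: "\<And>k. k < n \<Longrightarrow> u k \<in> carrier_vec n"
    and ev: "\<And>k. k < n \<Longrightarrow> M *\<^sub>v u k = eig (Suc k) M \<cdot>\<^sub>v u k"
    and orth: "\<And>j k. j < n \<Longrightarrow> k < n \<Longrightarrow> u j \<bullet> u k = (if j = k then 1 else 0)"
    and pars: "\<And>x y. x \<in> carrier_vec n \<Longrightarrow> y \<in> carrier_vec n \<Longrightarrow>
      x \<bullet> y = (\<Sum>k<n. (u k \<bullet> x) * (u k \<bullet> y))"
    using that by (rule orthonormal_eigenbasis[OF M sym])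
  have nonneg: "0 \<le> eig (Suc k) M" if "k < n" for k
    using psd[OF u[OF that]] u[OF that] ev[OF that] orth[OF that that] by simp
  have zz: "z \<bullet> z > 0" using scalar_prod_self_pos z by blast
  show pos: "0 < eig 2 M"
  proof (rule ccontr)
    assume "\<not> 0 < eig 2 M"
    then have e2: "eig 2 M = 0" using nonneg[of 1] n by (simp add: numeral_2_eq_2)
    then have e1: "eig 1 M = 0" using nonneg[of 0] eig_mono[OF M sym, of 1 2] n by simp
    have "M *\<^sub>v u 0 = 0\<^sub>v n" "M *\<^sub>v u 1 = 0\<^sub>v n"
      using ev[of 0] ev[of 1] u[of 0] u[of 1] e1 e2 n by (auto simp: numeral_2_eq_2)
    then obtain c d where cd: "u 0 = c \<cdot>\<^sub>v z" "u 1 = d \<cdot>\<^sub>v z"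
      using kernel[OF u[of 0]] kernel[OF u[of 1]] n by auto
    have "c * (d * (z \<bullet> z)) = 0" "c * (c * (z \<bullet> z)) = 1" "d * (d * (z \<bullet> z)) = 1"
      using orth[of 0 1] orth[of 0 0] orth[of 1 1] n z(1) unfolding cd by auto
    then show False by auto
  qed
  show "eig 2 M * (x \<bullet> x) \<le> x \<bullet> (M *\<^sub>v x)" if x: "x \<in> carrier_vec n" and xz: "x \<bullet> z = 0" for x
  proof -
    have uz: "u k \<bullet> z = 0" if "k < n" "k \<noteq> 0" for k
    proof -
      have "eig (Suc k) M * (u k \<bullet> z) = u k \<bullet> (M *\<^sub>v z)"
        using symmetric_scalar_prod_swap[OF M sym z(1) u[OF that(1)]] ev u z that by simp
      also have "\<dots> = 0" using z u that by simp
      finally show ?thesis using pos eig_mono[OF M sym, of 2 "Suc k"] that by auto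
    qed
    have first: "y \<bullet> z = (u 0 \<bullet> y) * (u 0 \<bullet> z)" if y: "y \<in> carrier_vec n" for y
      using pars[OF y z(1)] uz n by (subst (asm) sum.remove[of _ 0]) (auto intro!: sum.neutral)
    have ux: "u 0 \<bullet> x = 0" using first[OF x] first[OF z(1)] xz zz by auto
    have "eig 2 M * (x \<bullet> x) = (\<Sum>k<n. eig 2 M * (u k \<bullet> x)\<^sup>2)"
      using pars[OF x x] by (simp add: sum_distrib_left power2_eq_square)
    also have "\<dots> \<le> (\<Sum>k<n. eig (Suc k) M * (u k \<bullet> x)\<^sup>2)"
    proof (rule sum_mono)
      fix k assume "k \<in> {..<n}"
      then show "eig 2 M * (u k \<bullet> x)\<^sup>2 \<le> eig (Suc k) M * (u k \<bullet> x)\<^sup>2"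
        using ux eig_mono[OF M sym, of 2 "Suc k"] by (cases "k = 0") (auto intro: mult_right_mono)
    qed
    also have "\<dots> = x \<bullet> (M *\<^sub>v x)"
      by (rule quadratic_form_eigen_expansion[OF M sym x u ev pars, symmetric])
    finally show ?thesis .
  qed
qed

section \<open>The graph Laplacian\<close>

lemma laplacian_mult_vec:
  fixes B :: "real mat"
  assumes B: "B \<in> carrier_mat n n" and x: "x \<in> carrier_vec n" and i: "i < n"
  shows "(laplacian B *\<^sub>v x) $ i = (\<Sum>j<n. B $$ (i, j) * (x $ i - x $ j))"
proof -
  have "(laplacian B *\<^sub>v x) $ i = (\<Sum>j<n. laplacian B $$ (i, j) * x $ j)"
    using B x i by (simp add: laplacian_def scalar_prod_def atLeast0LessThan)
  also have "\<dots> = (\<Sum>k\<in>{..<n} - {i}. B $$ (i, k)) * x $ i - (\<Sum>k\<in>{..<n} - {i}. B $$ (i, k) * x $ k)"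
    using B i by (subst sum.remove[of _ i]) (auto simp: laplacian_def sum_negf)
  also have "\<dots> = (\<Sum>j\<in>{..<n} - {i}. B $$ (i, j) * (x $ i - x $ j))"
    by (simp add: sum_distrib_left sum_subtractf algebra_simps)
  also have "\<dots> = (\<Sum>j<n. B $$ (i, j) * (x $ i - x $ j))"
    using i by (subst (2) sum.remove[of _ i]) auto
  finally show ?thesis .
qed

lemma laplacian_carrier: "B \<in> carrier_mat n n \<Longrightarrow> laplacian B \<in> carrier_mat n n"
  by (auto simp: laplacian_def)

lemma laplacian_symmetric: "B \<in> carrier_mat n n \<Longrightarrow> B\<^sup>T = B \<Longrightarrow> (laplacian B)\<^sup>T = laplacian B"
proof -
  assume B: "B \<in> carrier_mat n n" "B\<^sup>T = B"
  have "B $$ (i, j) = B $$ (j, i)" if "i < n" "j < n" for i j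
    using arg_cong[OF B(2), of "\<lambda>C. C $$ (i, j)"] B(1) that by simp
  then show ?thesis using B(1) by (intro eq_matI) (auto simp: laplacian_def)
qed

text \<open>
  Averaging the contributions of \<open>(i, j)\<close> and \<open>(j, i)\<close> turns \<open>x\<^sub>i (x\<^sub>i - x\<^sub>j)\<close> into half a square.
\<close>

lemma laplacian_quadratic_form:
  fixes B :: "real mat"
  assumes B: "B \<in> carrier_mat n n" and sym: "B\<^sup>T = B" and x: "x \<in> carrier_vec n"
  shows "2 * (x \<bullet> (laplacian B *\<^sub>v x)) = (\<Sum>i<n. \<Sum>j<n. B $$ (i, j) * (x $ j - x $ i)\<^sup>2)"
proof -
  have symB: "B $$ (i, j) = B $$ (j, i)" if "i < n" "j < n" for i j
    using arg_cong[OF sym, of "\<lambda>C. C $$ (i, j)"] B that by simp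
  let ?S = "\<Sum>i<n. \<Sum>j<n. B $$ (i, j) * (x $ i * (x $ i - x $ j))"
  have dim: "dim_vec (laplacian B *\<^sub>v x) = n" using laplacian_carrier[OF B] by simp
  have S: "x \<bullet> (laplacian B *\<^sub>v x) = ?S"
    unfolding scalar_prod_def dim atLeast0LessThan
    by (intro sum.cong refl, subst laplacian_mult_vec[OF B x])
      (auto simp: sum_distrib_left mult.left_commute)
  have "?S = (\<Sum>i<n. \<Sum>j<n. B $$ (i, j) * (x $ j * (x $ j - x $ i)))"
    by (subst sum.swap) (auto intro!: sum.cong simp: symB)
  then have "2 * ?S = ?S + \<dots>" by simp
  also have "\<dots> = (\<Sum>i<n. \<Sum>j<n. B $$ (i, j) * (x $ j - x $ i)\<^sup>2)"
    unfolding sum.distrib[symmetric] by (intro sum.cong) (auto simp: power2_eq_square algebra_simps)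
  finally show ?thesis using S by simp
qed

lemma constant_on_connected_graph:
  assumes conn: "Digraph_Component.connected (with_proj (graph_of_mat A))" and A: "A \<in> carrier_mat n n"
    and edge: "\<And>i j. i < n \<Longrightarrow> j < n \<Longrightarrow> A $$ (i, j) > 0 \<Longrightarrow> f i = f j"
    and ij: "i < n" "j < n"
  shows "f i = f j"
proof -
  let ?G = "mk_symmetric (with_proj (graph_of_mat A))"
  have "(i, j) \<in> (arcs_ends (with_proj ?G))\<^sup>*"
    using conn ij A unfolding connected_def strongly_connected_def
    by (intro reachable_rtranclI) (auto simp: graph_of_mat_def)
  then show ?thesis
  proof (induction rule: rtrancl_induct)
    case (step x y)
    from step(2) have "f x = f y"
      using A edge by (fastforce simp: arcs_ends_def arc_to_ends_def parcs_mk_symmetric graph_of_mat_def)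
    with step show ?case by simp
  qed simp
qed

section \<open>The decay rate as an edge energy\<close>

definition edge_energy :: "real mat \<Rightarrow> real \<Rightarrow> real vec \<Rightarrow> real" where
  "edge_energy A \<alpha> x =
    (\<Sum>i<dim_vec x. \<Sum>j<dim_vec x. A $$ (i, j) * \<bar>x $ j - x $ i\<bar> powr (1 + \<alpha>))"

lemma sum_disagreement: "(\<Sum>i<dim_vec x. disagreement x i) = 0"
  by (cases "dim_vec x = 0") (simp_all add: disagreement_def sum_subtractf)

text \<open>
  Moving coordinate \<open>i\<close> by \<open>s\<close> changes the disagreement \<open>\<delta>\<^sub>k\<close> by \<open>s c\<^sub>k\<close> with
  \<open>c\<^sub>k = [k = i] - 1 / n\<close>. The derivative \<open>\<Sum>\<^sub>k \<delta>\<^sub>k c\<^sub>k\<close> is \<open>\<delta>\<^sub>i\<close> because the disagreements sum to zero.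
\<close>

lemma partial_deriv_V3:
  assumes i: "i < dim_vec x"
  shows "partial_deriv V\<^sub>3 i x = disagreement x i"
proof -
  let ?n = "dim_vec x"
  define c where "c k = (if k = i then 1 else 0) - 1 / real ?n" for k
  have upd: "(x |\<^sub>v i \<mapsto> t) $ k = x $ k + (t - x $ i) * (if k = i then 1 else 0)" if "k < ?n" for k t
    using that i by (cases "k = i") auto
  have dis: "disagreement (x |\<^sub>v i \<mapsto> t) k = disagreement x k + (t - x $ i) * c k" if k: "k < ?n" for k t
  proof -
    have total: "(\<Sum>k<?n. (x |\<^sub>v i \<mapsto> t) $ k) = (\<Sum>k<?n. x $ k) + (t - x $ i)"
      using i by (simp add: upd sum.distrib flip: sum_distrib_left)
    show ?thesis unfolding disagreement_def c_def dim_update_vec total upd[OF k]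
      by (simp add: algebra_simps add_divide_distrib diff_divide_distrib)
  qed
  have "((\<lambda>t. V\<^sub>3 (x |\<^sub>v i \<mapsto> t)) has_real_derivative (\<Sum>k<?n. disagreement x k * c k)) (at (x $ i))"
    unfolding V\<^sub>3_def by (auto simp: dis intro!: derivative_eq_intros sum.cong simp flip: sum_distrib_left)
  moreover have "(\<Sum>k<?n. disagreement x k * c k) = disagreement x i"
    using i sum_disagreement[of x]
    by (simp add: c_def right_diff_distrib sum_subtractf if_distrib[of "(*) _"] cong: if_cong flip: sum_divide_distrib)
  ultimately show ?thesis unfolding partial_deriv_def by (simp add: DERIV_imp_deriv)
qed

text \<open>
  Symmetrising the double sum replaces \<open>\<delta>\<^sub>i\<close> by half of \<open>\<delta>\<^sub>i - \<delta>\<^sub>j = x\<^sub>i - x\<^sub>j\<close>, and the product of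
  \<open>x\<^sub>j - x\<^sub>i\<close> with its signed power is \<open>\<bar>x\<^sub>j - x\<^sub>i\<bar> powr (1 + \<alpha>)\<close>.
\<close>

lemma deriv_along_V3:
  assumes A: "A \<in> carrier_mat n n" "A\<^sup>T = A" and x: "x \<in> carrier_vec n"
  shows "deriv_along V\<^sub>3 (protocol A \<alpha>) x = - edge_energy A \<alpha> x / 2"
proof -
  have n: "dim_vec x = n" using x by simp
  have symA: "A $$ (i, j) = A $$ (j, i)" if "i < n" "j < n" for i j
    using arg_cong[OF A(2), of "\<lambda>C. C $$ (i, j)"] A(1) that by simp
  have odd: "sig \<alpha> (a - b) = - sig \<alpha> (b - a)" for a b
    by (simp add: sig_def sgn_if)
  have power: "(b - a) * sig \<alpha> (b - a) = \<bar>b - a\<bar> powr (1 + \<alpha>)" for a b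
    by (cases "a = b") (auto simp: sig_def powr_add sgn_if abs_if)
  let ?d = "disagreement x"
  let ?D = "\<Sum>i<n. \<Sum>j<n. A $$ (i, j) * (?d i * sig \<alpha> (x $ j - x $ i))"
  have D: "deriv_along V\<^sub>3 (protocol A \<alpha>) x = ?D"
    unfolding deriv_along_def n
    by (intro sum.cong) (auto simp: partial_deriv_V3 n protocol_def sum_distrib_left mult.left_commute)
  have "?D = (\<Sum>i<n. \<Sum>j<n. A $$ (i, j) * (?d j * sig \<alpha> (x $ i - x $ j)))"
    by (subst sum.swap) (auto intro!: sum.cong simp: symA)
  then have "2 * ?D = ?D + \<dots>" by simp
  also have "\<dots> = (\<Sum>i<n. \<Sum>j<n. - (A $$ (i, j) * ((x $ j - x $ i) * sig \<alpha> (x $ j - x $ i))))"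
    unfolding sum.distrib[symmetric]
    by (intro sum.cong refl) (subst odd, simp add: disagreement_def algebra_simps)
  also have "\<dots> = - edge_energy A \<alpha> x"
    unfolding power edge_energy_def n by (simp add: sum_negf)
  finally show ?thesis using D by simp
qed

section \<open>Energy bounds on a connected graph and the comparison of exponents\<close>

text \<open>
  With \<open>d = \<beta> - \<alpha>\<close>, the logarithm of the conclusion is equivalent to \<open>d * ln \<epsilon> \<le> d * ln V\<close>, so the
  sign of \<open>d\<close> decides on which side of \<open>\<epsilon>\<close> it holds. The factor \<open>2 powr (-2)\<close> in \<open>\<epsilon>\<close> absorbs the
  factor \<open>4\<close> in front of \<open>V\<close>.
\<close>

lemma threshold_comparison:
  fixes N K L V \<alpha> \<beta> \<epsilon> :: real
  assumes pos: "N > 0" "K > 0" "L > 0" "V > 0"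
    and \<epsilon>: "\<epsilon> = 2 powr (-2) * N powr (2 * (1 - \<alpha>) / (\<beta> - \<alpha>)) * L powr ((1 + \<alpha>) / (\<beta> - \<alpha>))
      * K powr ((1 + \<beta>) / (\<alpha> - \<beta>))"
    and side: "\<alpha> < \<beta> \<and> \<epsilon> \<le> V \<or> \<beta> < \<alpha> \<and> V \<le> \<epsilon>"
  shows "N powr (1 - \<alpha>) * (4 * L * V) powr ((1 + \<alpha>) / 2) \<le> (4 * K * V) powr ((1 + \<beta>) / 2)"
proof -
  define d where "d = \<beta> - \<alpha>"
  have d: "d \<noteq> 0" using side unfolding d_def by auto
  have ab: "\<alpha> - \<beta> = - d" "\<beta> - \<alpha> = d" unfolding d_def by auto
  have \<epsilon>pos: "\<epsilon> > 0" using \<epsilon> pos by simp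
  have ln4: "ln 4 = 2 * ln (2::real)" using ln_realpow[of 2 2] by simp
  have ln\<epsilon>: "ln \<epsilon> = - 2 * ln 2 + 2 * (1 - \<alpha>) / d * ln N + (1 + \<alpha>) / d * ln L
      + (1 + \<beta>) / (- d) * ln K"
    unfolding \<epsilon> ab using pos by (simp add: ln_mult ln_powr)
  have dln: "d * ln \<epsilon> = - 2 * d * ln 2 + 2 * (1 - \<alpha>) * ln N + (1 + \<alpha>) * ln L - (1 + \<beta>) * ln K"
    unfolding ln\<epsilon> using d by (simp add: field_simps)
  have "d * ln \<epsilon> \<le> d * ln V"
    using side
  proof
    assume "\<alpha> < \<beta> \<and> \<epsilon> \<le> V"
    then show ?thesis using \<epsilon>pos pos unfolding d_def by (intro mult_left_mono) auto
  next
    assume "\<beta> < \<alpha> \<and> V \<le> \<epsilon>"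
    then show ?thesis using \<epsilon>pos pos unfolding d_def by (intro mult_left_mono_neg) auto
  qed
  then have "ln (N powr (1 - \<alpha>) * (4 * L * V) powr ((1 + \<alpha>) / 2)) \<le> ln ((4 * K * V) powr ((1 + \<beta>) / 2))"
    unfolding dln using pos by (simp add: ln_mult ln_powr ln4 d_def field_simps)
  then show ?thesis using pos by (subst (asm) ln_le_cancel_iff) simp_all
qed

locale weighted_connected_graph =
  fixes A :: "real mat" and n :: nat
  assumes n: "2 \<le> n"
    and A: "A \<in> carrier_mat n n"
    and nonneg: "\<And>i j. i < n \<Longrightarrow> j < n \<Longrightarrow> 0 \<le> A $$ (i, j)"
    and sym: "A\<^sup>T = A"
    and conn: "Digraph_Component.connected (with_proj (graph_of_mat A))"
begin

lemma power_mat_carrier: "power_mat A \<alpha> \<in> carrier_mat n n"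
  using A by (simp add: power_mat_def)

lemma power_mat_sym: "(power_mat A \<alpha>)\<^sup>T = power_mat A \<alpha>"
  unfolding power_mat_def by (metis map_mat_transpose sym)

lemmas lap_carrier = laplacian_carrier[OF power_mat_carrier]
lemmas lap_sym = laplacian_symmetric[OF power_mat_carrier power_mat_sym]
lemmas lap_form = laplacian_quadratic_form[OF power_mat_carrier power_mat_sym]

lemma power_mat_nonneg: "i < n \<Longrightarrow> j < n \<Longrightarrow> 0 \<le> power_mat A \<alpha> $$ (i, j)"
  using A by (simp add: power_mat_def)

lemma lap_psd:
  assumes x: "x \<in> carrier_vec n"
  shows "0 \<le> x \<bullet> (laplacian (power_mat A \<alpha>) *\<^sub>v x)"
proof -
  have "0 \<le> 2 * (x \<bullet> (laplacian (power_mat A \<alpha>) *\<^sub>v x))"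
    unfolding lap_form[OF x] by (intro sum_nonneg mult_nonneg_nonneg power_mat_nonneg) auto
  then show ?thesis by simp
qed

text \<open>
  On the kernel the quadratic form vanishes, and all its terms are nonnegative; so \<open>y\<close> takes equal
  values at the ends of every edge.
\<close>

lemma lap_kernel_constant:
  assumes y: "y \<in> carrier_vec n" and ker: "laplacian (power_mat A \<alpha>) *\<^sub>v y = 0\<^sub>v n"
  shows "\<exists>c. y = c \<cdot>\<^sub>v vec n (\<lambda>_. 1)"
proof -
  let ?B = "power_mat A \<alpha>"
  have "(\<Sum>i<n. \<Sum>j<n. ?B $$ (i, j) * (y $ j - y $ i)\<^sup>2) = 0"
    using lap_form[OF y, symmetric] ker y by simp
  then have sum0: "(\<Sum>(i, j)\<in>{..<n} \<times> {..<n}. ?B $$ (i, j) * (y $ j - y $ i)\<^sup>2) = 0"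
    by (simp only: sum.cartesian_product)
  have zero: "?B $$ (i, j) * (y $ j - y $ i)\<^sup>2 = 0" if "i < n" "j < n" for i j
    using sum_nonneg_0[OF _ _ sum0, of "(i, j)"] that power_mat_nonneg by fastforce
  have edge: "y $ i = y $ j" if "i < n" "j < n" "A $$ (i, j) > 0" for i j
    using zero[OF that(1,2)] A that by (simp add: power_mat_def)
  define c where "c = y $ 0"
  have yc: "y $ i = c" if "i < n" for i
    unfolding c_def by (rule constant_on_connected_graph[OF conn A, of "($) y", OF edge])
      (use that n in linarith)+
  have "y = c \<cdot>\<^sub>v vec n (\<lambda>_. 1)" using y yc by (intro eq_vecI) auto
  then show ?thesis ..
qed

lemma lap_constant: "laplacian (power_mat A \<alpha>) *\<^sub>v vec n (\<lambda>_. 1) = 0\<^sub>v n"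
  by (rule eq_vecI)
    (use lap_carrier in \<open>auto simp: laplacian_mult_vec[OF power_mat_carrier] simp del: index_mult_mat_vec\<close>)

lemma one_vec_nonzero: "vec n (\<lambda>_. 1 :: real) \<noteq> 0\<^sub>v n"
proof
  assume "vec n (\<lambda>_. 1 :: real) = 0\<^sub>v n"
  then have "vec n (\<lambda>_. 1 :: real) $ 0 = 0\<^sub>v n $ 0" by simp
  then show False using n by simp
qed

lemma eig2_pos: "0 < eig 2 (laplacian (power_mat A \<alpha>))"
  by (rule second_eigenvalue_of_simple_kernel(1)[OF lap_carrier[of \<alpha>] lap_sym n lap_psd vec_carrier
      one_vec_nonzero lap_constant lap_kernel_constant[of _ \<alpha>]])

lemma spectral_gap_inequality:
  assumes "d \<in> carrier_vec n" and "d \<bullet> vec n (\<lambda>_. 1) = 0"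
  shows "eig 2 (laplacian (power_mat A \<alpha>)) * (d \<bullet> d) \<le> d \<bullet> (laplacian (power_mat A \<alpha>) *\<^sub>v d)"
  by (rule second_eigenvalue_of_simple_kernel(2)[OF lap_carrier[of \<alpha>] lap_sym n lap_psd vec_carrier
      one_vec_nonzero lap_constant lap_kernel_constant[of _ \<alpha>] assms])

lemma eign_pos: "0 < eig n (laplacian (power_mat A \<alpha>))"
proof -
  have "eig 2 (laplacian (power_mat A \<alpha>)) \<le> eig n (laplacian (power_mat A \<alpha>))"
    using n by (intro eig_mono[OF lap_carrier lap_sym]) auto
  then show ?thesis using eig2_pos[of \<alpha>] by linarith
qed

text \<open>
  Differences of coordinates agree for \<open>x\<close> and its disagreement vector \<open>d\<close>, and \<open>d \<bullet> d = 2 V\<^sub>3 x\<close>.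
\<close>

lemma laplacian_bounds:
  assumes x: "x \<in> carrier_vec n"
  defines "S \<equiv> \<lambda>\<alpha>. \<Sum>i<n. \<Sum>j<n. power_mat A \<alpha> $$ (i, j) * (x $ j - x $ i)\<^sup>2"
  shows "4 * eig 2 (laplacian (power_mat A \<alpha>)) * V\<^sub>3 x \<le> S \<alpha>"
    and "S \<alpha> \<le> 4 * eig n (laplacian (power_mat A \<alpha>)) * V\<^sub>3 x"
proof -
  define d where "d = vec n (disagreement x)"
  have d: "d \<in> carrier_vec n" unfolding d_def by simp
  have dx: "dim_vec x = n" using x by simp
  have dd: "d \<bullet> d = 2 * V\<^sub>3 x"
    unfolding V\<^sub>3_def d_def scalar_prod_def dx by (simp add: atLeast0LessThan power2_eq_square)
  have d1: "d \<bullet> vec n (\<lambda>_. 1) = 0"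
    using sum_disagreement[of x] unfolding d_def scalar_prod_def dx by (simp add: atLeast0LessThan)
  have "2 * (d \<bullet> (laplacian (power_mat A \<alpha>) *\<^sub>v d)) = S \<alpha>"
    unfolding lap_form[OF d] S_def by (intro sum.cong) (auto simp: d_def disagreement_def)
  then show "4 * eig 2 (laplacian (power_mat A \<alpha>)) * V\<^sub>3 x \<le> S \<alpha>"
    "S \<alpha> \<le> 4 * eig n (laplacian (power_mat A \<alpha>)) * V\<^sub>3 x"
    using spectral_gap_inequality[OF d d1, of \<alpha>] rayleigh_le_largest_eigenvalue[OF lap_carrier lap_sym d, of \<alpha>] dd
    by (auto simp: algebra_simps)
qed

text \<open>
  The entrywise exponent \<open>2 / (1 + \<alpha>)\<close> of \<open>power_mat\<close> is chosen so that the weights pass inside the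
  common power \<open>(1 + \<alpha>) / 2\<close>.
\<close>

lemma edge_energy_power_sum:
  assumes x: "x \<in> carrier_vec n" and \<alpha>: "0 < \<alpha>"
  shows "edge_energy A \<alpha> x = (\<Sum>(i, j)\<in>{..<n} \<times> {..<n}.
    (power_mat A \<alpha> $$ (i, j) * (x $ j - x $ i)\<^sup>2) powr ((1 + \<alpha>) / 2))"
proof -
  have "a * \<bar>r\<bar> powr (1 + \<alpha>) = (a powr (2 / (1 + \<alpha>)) * r\<^sup>2) powr ((1 + \<alpha>) / 2)" if "0 \<le> a" for a r
  proof -
    have "r\<^sup>2 = \<bar>r\<bar> powr 2" by (cases "r = 0") (auto simp: powr_numeral)
    moreover have "2 * ((1 + \<alpha>) / 2) = 1 + \<alpha>" by simp
    ultimately have r: "(r\<^sup>2) powr ((1 + \<alpha>) / 2) = \<bar>r\<bar> powr (1 + \<alpha>)"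
      by (simp only: powr_powr)
    have "2 / (1 + \<alpha>) * ((1 + \<alpha>) / 2) = 1" using \<alpha> by simp
    then have "(a powr (2 / (1 + \<alpha>))) powr ((1 + \<alpha>) / 2) = a"
      using that by (simp only: powr_powr powr_one)
    then show ?thesis using that r by (simp add: powr_mult)
  qed
  then show ?thesis
    using x A nonneg unfolding edge_energy_def sum.cartesian_product
    by (intro sum.cong) (auto simp: power_mat_def)
qed

text \<open>
  The factor \<open>n powr (1 - \<alpha>)\<close> is \<open>N powr (1 - p)\<close> for \<open>p = (1 + \<alpha>) / 2\<close> and the number \<open>N = n\<^sup>2\<close> of
  index pairs.
\<close>

lemma edge_energy_bounds:
  assumes x: "x \<in> carrier_vec n" and \<alpha>: "0 < \<alpha>" "\<alpha> < 1"
  shows "(4 * eig 2 (laplacian (power_mat A \<alpha>)) * V\<^sub>3 x) powr ((1 + \<alpha>) / 2) \<le> edge_energy A \<alpha> x"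
    and "edge_energy A \<alpha> x \<le>
      real n powr (1 - \<alpha>) * (4 * eig n (laplacian (power_mat A \<alpha>)) * V\<^sub>3 x) powr ((1 + \<alpha>) / 2)"
proof -
  let ?y = "\<lambda>(i, j). power_mat A \<alpha> $$ (i, j) * (x $ j - x $ i)\<^sup>2"
  let ?I = "{..<n} \<times> {..<n}" and ?p = "(1 + \<alpha>) / 2"
  have y: "0 \<le> ?y k" if "k \<in> ?I" for k using that power_mat_nonneg by auto
  have p: "0 < ?p" "?p \<le> 1" using \<alpha> by auto
  have E: "edge_energy A \<alpha> x = (\<Sum>k\<in>?I. ?y k powr ?p)"
    unfolding edge_energy_power_sum[OF x \<alpha>(1)] by (simp add: case_prod_unfold)
  have S: "(\<Sum>k\<in>?I. ?y k) = (\<Sum>i<n. \<Sum>j<n. power_mat A \<alpha> $$ (i, j) * (x $ j - x $ i)\<^sup>2)"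
    by (simp add: sum.cartesian_product)
  have V: "0 \<le> V\<^sub>3 x" unfolding V\<^sub>3_def by (simp add: sum_nonneg)
  have "(4 * eig 2 (laplacian (power_mat A \<alpha>)) * V\<^sub>3 x) powr ?p \<le> (\<Sum>k\<in>?I. ?y k) powr ?p"
    unfolding S using laplacian_bounds(1)[OF x, of \<alpha>] V eig2_pos[of \<alpha>] p by (intro powr_mono2) auto
  also have "\<dots> \<le> edge_energy A \<alpha> x"
    unfolding E by (rule sum_powr_ge[OF _ y p]) auto
  finally show "(4 * eig 2 (laplacian (power_mat A \<alpha>)) * V\<^sub>3 x) powr ?p \<le> edge_energy A \<alpha> x" .
  have "edge_energy A \<alpha> x \<le> real (card ?I) powr (1 - ?p) * (\<Sum>k\<in>?I. ?y k) powr ?p"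
    unfolding E by (rule sum_powr_le[OF _ y p]) auto
  also have "real (card ?I) powr (1 - ?p) = real n powr (1 - \<alpha>)"
  proof -
    have "real (card ?I) = real n powr 2" using n by (simp add: powr_numeral power2_eq_square)
    moreover have "2 * (1 - ?p) = 1 - \<alpha>" by (simp add: field_simps)
    ultimately show ?thesis by (simp only: powr_powr)
  qed
  also have "real n powr (1 - \<alpha>) * (\<Sum>k\<in>?I. ?y k) powr ?p
      \<le> real n powr (1 - \<alpha>) * (4 * eig n (laplacian (power_mat A \<alpha>)) * V\<^sub>3 x) powr ?p"
    unfolding S using laplacian_bounds(2)[OF x, of \<alpha>] p sum_nonneg[of ?I ?y] y unfolding S
    by (intro mult_left_mono powr_mono2) auto
  finally show "edge_energy A \<alpha> x \<le>
      real n powr (1 - \<alpha>) * (4 * eig n (laplacian (power_mat A \<alpha>)) * V\<^sub>3 x) powr ?p" .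
qed

text \<open>
  At \<open>V\<^sub>3 x = 0\<close>, where logarithms are unavailable, both bounds are \<open>0\<close>.
\<close>

lemma edge_energy_comparison:
  assumes x: "x \<in> carrier_vec n" and \<alpha>: "0 < \<alpha>" "\<alpha> < 1" and \<beta>: "0 < \<beta>" "\<beta> < 1"
    and side: "\<alpha> < \<beta> \<and> eps_upper A \<alpha> \<beta> \<le> V\<^sub>3 x \<or> \<beta> < \<alpha> \<and> V\<^sub>3 x \<le> eps_upper A \<alpha> \<beta>"
  shows "edge_energy A \<alpha> x \<le> edge_energy A \<beta> x"
proof -
  have "real n powr (1 - \<alpha>) * (4 * eig n (laplacian (power_mat A \<alpha>)) * V\<^sub>3 x) powr ((1 + \<alpha>) / 2)
      \<le> (4 * eig 2 (laplacian (power_mat A \<beta>)) * V\<^sub>3 x) powr ((1 + \<beta>) / 2)"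
  proof (cases "V\<^sub>3 x = 0")
    case False
    moreover have "0 \<le> V\<^sub>3 x" unfolding V\<^sub>3_def by (simp add: sum_nonneg)
    ultimately have "0 < V\<^sub>3 x" by simp
    then show ?thesis
      using side n A eig2_pos[of \<beta>] eign_pos[of \<alpha>]
      by (intro threshold_comparison[where \<epsilon> = "eps_upper A \<alpha> \<beta>"]) (auto simp: eps_upper_def)
  qed simp
  then show ?thesis
    using edge_energy_bounds(2)[OF x \<alpha>] edge_energy_bounds(1)[OF x \<beta>] by linarith
qed

end

lemma eps_lower_eq_eps_upper: "eps_lower A \<alpha> \<beta> = eps_upper A \<beta> \<alpha>"
  unfolding eps_lower_def eps_upper_def ..

theorem theorem6:
  fixes n :: nat and A :: "real mat" and \<alpha>l \<alpha>u :: real and x :: "real vec"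
  assumes "n \<ge> 2"
    and "A \<in> carrier_mat n n"
    and "\<And>i j. i < n \<Longrightarrow> j < n \<Longrightarrow> A $$ (i, j) \<ge> 0"
    and "A\<^sup>T = A"
    and "\<And>i. i < n \<Longrightarrow> A $$ (i, i) = 0"
    and "Digraph_Component.connected (with_proj (graph_of_mat A))"
    and "0 < \<alpha>l" and "\<alpha>l < \<alpha>u" and "\<alpha>u < 1"
    and "x \<in> carrier_vec n"
  shows "(V\<^sub>3 x \<ge> eps_upper A \<alpha>l \<alpha>u \<longrightarrow>
            deriv_along V\<^sub>3 (protocol A \<alpha>u) x \<le> deriv_along V\<^sub>3 (protocol A \<alpha>l) x)
       \<and> (V\<^sub>3 x \<le> eps_lower A \<alpha>l \<alpha>u \<longrightarrow>
            deriv_along V\<^sub>3 (protocol A \<alpha>l) x \<le> deriv_along V\<^sub>3 (protocol A \<alpha>u) x)"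
proof -
  interpret weighted_connected_graph A n
    using assms by unfold_locales auto
  note compare = edge_energy_comparison[OF \<open>x \<in> carrier_vec n\<close>]
  show ?thesis
    unfolding deriv_along_V3[OF assms(2,4,10)] eps_lower_eq_eps_upper
    using compare[of \<alpha>l \<alpha>u] compare[of \<alpha>u \<alpha>l] assms(7-9) by auto
qed

end
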